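(* (Cut-elimination theorem for $\mathbf{IL}^-(\mathbf{P})_{\mathrm{seq}}$.) For any sequent $S$, if $S$ is provable in $\mathbf{IL}^-(\mathbf{P})_{\mathrm{seq}}$, then there exists a cut-free proof of $S$ in $\mathbf{IL}^-(\mathbf{P})_{\mathrm{seq}}$ (a proof not using the rule (cut)).
   Context: Formulas are built from propositional variables and $\bot$ with $\neg, \land, \lor, \to$ and a binary modal operator $\rhd$. A sequent is an expression $\Gamma \Rightarrow \Delta$ with $\Gamma, \Delta$ finite sets of formulas; $\Gamma, \Delta$ means $\Gamma \cup \Delta$ and $\Gamma, A$ means $\Gamma \cup \{A\}$. The system $\mathbf{IL}^-(\mathbf{P})_{\mathrm{seq}}$ has: Initial sequents: $A \Rightarrow A$ and $\bot \Rightarrow$. Logical rules: (wl) from $\Gamma \Rightarrow \Delta$ infer $\Gamma, A \Rightarrow \Delta$; (wr) from $\Gamma \Rightarrow \Delta$ infer $\Gamma \Rightarrow A, \Delta$; ($\neg$l) from $\Gamma \Rightarrow A, \Delta$ infer $\Gamma, \neg A \Rightarrow \Delta$; ($\neg$r) from $\Gamma, A \Rightarrow \Delta$ infer $\Gamma \Rightarrow \neg A, \Delta$; ($\land$l) from $\Gamma, A_i \Rightarrow \Delta$ ($i = 1$ or $2$) infer $\Gamma, A_1 \land A_2 \Rightarrow \Delta$; ($\land$r) from $\Gamma \Rightarrow A, \Delta$ and $\Gamma \Rightarrow B, \Delta$ infer $\Gamma \Rightarrow A \land B, \Delta$; ($\lor$l) from $\Gamma, A \Rightarrow \Delta$ and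 $\Gamma, B \Rightarrow \Delta$ infer $\Gamma, A \lor B \Rightarrow \Delta$; ($\lor$r) from $\Gamma \Rightarrow A_i, \Delta$ ($i=1$ or $2$) infer $\Gamma \Rightarrow A_1 \lor A_2, \Delta$; ($\to$l) from $\Gamma \Rightarrow A, \Delta$ and $\Gamma, B \Rightarrow \Delta$ infer $\Gamma, A \to B \Rightarrow \Delta$; ($\to$r) from $\Gamma, A \Rightarrow B, \Delta$ infer $\Gamma \Rightarrow A \to B, \Delta$. Cut rule: (cut) from $\Gamma \Rightarrow \Delta, A$ and $A, \Sigma \Rightarrow \Pi$ infer $\Gamma, \Sigma \Rightarrow \Delta, \Pi$. Modal rule: ($\rhd_{\mathbf{P}}$) for $n \geq 0$ and a (possibly empty) finite set $\Omega$ of formulas of the form $C \rhd D$, from $\Omega, \{X_i \rhd Y_i \mid i<n\}, A \rhd B, A \Rightarrow \{X_i \mid i<n\}$ and $Y_i \Rightarrow B$ for all $i<n$, infer $\Omega, \{X_i \rhd Y_i \mid i < n\} \Rightarrow A \rhd B$. *)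

theory Defs
  imports Main "HOL-Library.FSet"
begin

datatype 'v form =
    Var 'v
  | Bot
  | Neg "'v form"
  | And "'v form" "'v form"
  | Or "'v form" "'v form"
  | Imp "'v form" "'v form"
  | Rhd "'v form" "'v form" (infix "\<rhd>" 75)

text \<open>The antecedent and succedent are finite sets: contraction and exchange are implicit, and
  the principal formula of a rule may also occur in its context.\<close>

datatype 'v sequent = Sequent "'v form fset" "'v form fset" (infix "\<Rrightarrow>" 55)

datatype rule_name =
    Init | BotL | WL | WR | NegL | NegR | AndL | AndR | OrL | OrR | ImpL | ImpR | Cut | RhdP

text \<open>\<open>inference r Ps S\<close>: an instance of the rule \<open>r\<close> with list of premises \<open>Ps\<close> and
  conclusion \<open>S\<close>.\<close>

inductive inference :: "rule_name \<Rightarrow> 'v sequent list \<Rightarrow> 'v sequent \<Rightarrow> bool" where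
  Init: "inference Init [] ({|A|} \<Rrightarrow> {|A|})"
| BotL: "inference BotL [] ({|Bot|} \<Rrightarrow> {||})"
| WL: "inference WL [\<Gamma> \<Rrightarrow> \<Delta>] (finsert A \<Gamma> \<Rrightarrow> \<Delta>)"
| WR: "inference WR [\<Gamma> \<Rrightarrow> \<Delta>] (\<Gamma> \<Rrightarrow> finsert A \<Delta>)"
| NegL: "inference NegL [\<Gamma> \<Rrightarrow> finsert A \<Delta>] (finsert (Neg A) \<Gamma> \<Rrightarrow> \<Delta>)"
| NegR: "inference NegR [finsert A \<Gamma> \<Rrightarrow> \<Delta>] (\<Gamma> \<Rrightarrow> finsert (Neg A) \<Delta>)"
| AndL1: "inference AndL [finsert A \<Gamma> \<Rrightarrow> \<Delta>] (finsert (And A B) \<Gamma> \<Rrightarrow> \<Delta>)"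
| AndL2: "inference AndL [finsert B \<Gamma> \<Rrightarrow> \<Delta>] (finsert (And A B) \<Gamma> \<Rrightarrow> \<Delta>)"
| AndR: "inference AndR [\<Gamma> \<Rrightarrow> finsert A \<Delta>, \<Gamma> \<Rrightarrow> finsert B \<Delta>] (\<Gamma> \<Rrightarrow> finsert (And A B) \<Delta>)"
| OrL: "inference OrL [finsert A \<Gamma> \<Rrightarrow> \<Delta>, finsert B \<Gamma> \<Rrightarrow> \<Delta>] (finsert (Or A B) \<Gamma> \<Rrightarrow> \<Delta>)"
| OrR1: "inference OrR [\<Gamma> \<Rrightarrow> finsert A \<Delta>] (\<Gamma> \<Rrightarrow> finsert (Or A B) \<Delta>)"
| OrR2: "inference OrR [\<Gamma> \<Rrightarrow> finsert B \<Delta>] (\<Gamma> \<Rrightarrow> finsert (Or A B) \<Delta>)"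
| ImpL: "inference ImpL [\<Gamma> \<Rrightarrow> finsert A \<Delta>, finsert B \<Gamma> \<Rrightarrow> \<Delta>] (finsert (Imp A B) \<Gamma> \<Rrightarrow> \<Delta>)"
| ImpR: "inference ImpR [finsert A \<Gamma> \<Rrightarrow> finsert B \<Delta>] (\<Gamma> \<Rrightarrow> finsert (Imp A B) \<Delta>)"
| Cut: "inference Cut [\<Gamma> \<Rrightarrow> finsert A \<Delta>, finsert A \<Sigma> \<Rrightarrow> \<Pi>] (\<Gamma> |\<union>| \<Sigma> \<Rrightarrow> \<Delta> |\<union>| \<Pi>)"
| RhdP: "(\<And>F. F |\<in>| \<Omega> \<Longrightarrow> \<exists>C D. F = C \<rhd> D) \<Longrightarrow>
    inference RhdP
      ((finsert A (finsert (A \<rhd> B) (\<Omega> |\<union>| (\<lambda>i. X i \<rhd> Y i) |`| fset_of_list [0..<n]))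
          \<Rrightarrow> X |`| fset_of_list [0..<n])
        # map (\<lambda>i. {|Y i|} \<Rrightarrow> {|B|}) [0..<n])
      (\<Omega> |\<union>| (\<lambda>i. X i \<rhd> Y i) |`| fset_of_list [0..<n] \<Rrightarrow> {|A \<rhd> B|})"

text \<open>Each node carries the name of the rule applied there, since one and the same inference
  step may be an instance of several rules (possibly of cut among them).\<close>

datatype 'v proof_tree = Node (rule: rule_name) (conclusion: "'v sequent") (subproofs: "'v proof_tree list")

fun is_proof :: "'v proof_tree \<Rightarrow> bool" where
  "is_proof (Node r S ps) \<longleftrightarrow> inference r (map conclusion ps) S \<and> (\<forall>p\<in>set ps. is_proof p)"

fun cut_free :: "'v proof_tree \<Rightarrow> bool" where
  "cut_free (Node r S ps) \<longleftrightarrow> r \<noteq> Cut \<and> (\<forall>p\<in>set ps. cut_free p)"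

definition proof_of :: "'v proof_tree \<Rightarrow> 'v sequent \<Rightarrow> bool" where
  "proof_of p S \<longleftrightarrow> is_proof p \<and> conclusion p = S"

definition provable :: "'v sequent \<Rightarrow> bool" where
  "provable S \<longleftrightarrow> (\<exists>p. proof_of p S)"

end

theory Submission
  imports Defs
begin

text \<open>
  The proof is semantic: every rule, (cut) included, is sound for a class of relational models,
  and the rules other than (cut) are already complete for it.

  The models are those of interpretability logic.  A world \<open>w\<close> has \<open>R\<close>-successors, and it carries
  its own relation \<open>S w\<close>; \<open>A \<rhd> B\<close> holds at \<open>w\<close> if every \<open>R\<close>-successor of \<open>w\<close> where \<open>A\<close> holds
  is \<open>S w\<close>-related to a world where \<open>B\<close> holds.  \<open>R\<close> is transitive and conversely well-founded,
  and \<open>S w\<close> restricted to the successors of an \<open>R\<close>-successor \<open>x\<close> of \<open>w\<close> is contained in \<open>S x\<close>.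
  The last condition makes formulas \<open>A \<rhd> B\<close> persist along \<open>R\<close>, and so justifies keeping
  the side formulas in the first premise of the modal rule.  It also turns a counterexample to
  \<open>A \<rhd> B\<close> at \<open>x\<close> into one at \<open>w\<close>, so that an \<open>R\<close>-last counterexample itself satisfies
  \<open>A \<rhd> B\<close>; this justifies the presence of \<open>A \<rhd> B\<close> in that premise
  (\<open>provable_imp_valid\<close>).

  For completeness, fix a finite subformula-closed set \<open>\<Phi>\<close>.  The worlds are the maximal sequents
  over \<open>\<Phi>\<close> without a cut-free proof, each paired with a formula, its tag.  The tag of \<open>x\<close> is the formula
  that the worlds reachable from \<open>x\<close> by any \<open>S w\<close> must refute: \<open>S w x y\<close> says that the tag of \<open>x\<close> is
  in the succedent of \<open>y\<close>.  Reading the modal rule backwards shows that every \<open>A \<rhd> B\<close> in the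
  succedent of \<open>w\<close> has a counterexample \<open>x\<close> with tag \<open>B\<close>.  No closure under cut is used in the truth lemma
  (\<open>truth_lemma\<close>), because it only asserts that a world satisfies the formulas of its
  antecedent and refutes those of its succedent; formulas on neither side are left open.
  A sequent without a cut-free proof extends to a world, which refutes it, so by soundness it has
  no proof at all.
\<close>

section \<open>Kripke-style semantics and soundness\<close>

primrec forces :: "('w \<Rightarrow> 'w \<Rightarrow> bool) \<Rightarrow> ('w \<Rightarrow> 'w \<Rightarrow> 'w \<Rightarrow> bool) \<Rightarrow> ('w \<Rightarrow> 'v \<Rightarrow> bool) \<Rightarrow>
    'w \<Rightarrow> 'v form \<Rightarrow> bool" where
  "forces R S V w (Var p) = V w p"
| "forces R S V w Bot = False"
| "forces R S V w (Neg A) = (\<not> forces R S V w A)"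
| "forces R S V w (And A B) = (forces R S V w A \<and> forces R S V w B)"
| "forces R S V w (Or A B) = (forces R S V w A \<or> forces R S V w B)"
| "forces R S V w (Imp A B) = (forces R S V w A \<longrightarrow> forces R S V w B)"
| "forces R S V w (A \<rhd> B) =
    (\<forall>x. R w x \<longrightarrow> forces R S V x A \<longrightarrow> (\<exists>y. S w x y \<and> forces R S V y B))"

fun valid :: "('w \<Rightarrow> 'w \<Rightarrow> bool) \<Rightarrow> ('w \<Rightarrow> 'w \<Rightarrow> 'w \<Rightarrow> bool) \<Rightarrow> ('w \<Rightarrow> 'v \<Rightarrow> bool) \<Rightarrow>
    'v sequent \<Rightarrow> bool" where
  "valid R S V (\<Gamma> \<Rrightarrow> \<Delta>) \<longleftrightarrow>
    (\<forall>w. (\<forall>F |\<in>| \<Gamma>. forces R S V w F) \<longrightarrow> (\<exists>F |\<in>| \<Delta>. forces R S V w F))"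

locale persistent_frame =
  fixes R :: "'w \<Rightarrow> 'w \<Rightarrow> bool" and S :: "'w \<Rightarrow> 'w \<Rightarrow> 'w \<Rightarrow> bool"
  assumes R_trans: "R w x \<Longrightarrow> R x y \<Longrightarrow> R w y"
    and R_conversely_wf: "wf {(x, w). R w x}"
    and S_persistent: "R w x \<Longrightarrow> R x y \<Longrightarrow> S w y z \<Longrightarrow> S x y z"
begin

lemma forces_rhd_persistent:
  assumes "R w x" "forces R S V w (A \<rhd> B)"
  shows "forces R S V x (A \<rhd> B)"
  using assms(2) R_trans[OF assms(1)] S_persistent[OF assms(1)] unfolding forces.simps by blast

text \<open>A failure of \<open>A \<rhd> B\<close> at a successor \<open>x\<close> of \<open>w\<close> is witnessed by a world that is also a
  counterexample at \<open>w\<close>, and lies above \<open>x\<close>.  So an \<open>R\<close>-last counterexample, which exists by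
  converse well-foundedness, forces \<open>A \<rhd> B\<close>.\<close>

lemma last_counterexample:
  assumes "\<not> forces R S V w (A \<rhd> B)"
  obtains x where "R w x" "forces R S V x A" "forces R S V x (A \<rhd> B)"
    "\<And>y. S w x y \<Longrightarrow> \<not> forces R S V y B"
proof -
  define Q where "Q = {x. R w x \<and> forces R S V x A \<and> (\<forall>y. S w x y \<longrightarrow> \<not> forces R S V y B)}"
  from assms obtain x0 where "x0 \<in> Q" by (auto simp: Q_def)
  from wfE_min[OF R_conversely_wf this]
  obtain x where x: "x \<in> Q" and last: "\<And>y. R x y \<Longrightarrow> y \<notin> Q" by auto
  have "forces R S V x (A \<rhd> B)"
  proof (rule ccontr)
    assume "\<not> forces R S V x (A \<rhd> B)"
    then obtain y where "R x y" "forces R S V y A" "\<forall>z. S x y z \<longrightarrow> \<not> forces R S V z B" by auto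
    moreover have "R w x" using x by (simp add: Q_def)
    ultimately have "y \<in> Q" using R_trans S_persistent unfolding Q_def by blast
    with last \<open>R x y\<close> show False by blast
  qed
  with x that show thesis unfolding Q_def by blast
qed

lemma inference_sound:
  assumes "inference r Ps T" "\<And>P. P \<in> set Ps \<Longrightarrow> valid R S V P"
  shows "valid R S V T"
proof -
  have prems: "\<forall>P \<in> set Ps. valid R S V P" using assms(2) by blast
  show ?thesis using assms(1)
  proof cases
    case (RhdP \<Omega> A B X Y n)
    let ?\<Gamma> = "\<Omega> |\<union>| (\<lambda>i. X i \<rhd> Y i) |`| fset_of_list [0..<n]"
    have "valid R S V (finsert A (finsert (A \<rhd> B) ?\<Gamma>) \<Rrightarrow> X |`| fset_of_list [0..<n])"
      using prems RhdP(2) by (simp del: valid.simps)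
    then have main: "\<exists>i<n. forces R S V x (X i)"
      if "forces R S V x A" "forces R S V x (A \<rhd> B)" "\<And>F. F |\<in>| ?\<Gamma> \<Longrightarrow> forces R S V x F" for x
      using that by (fastforce simp: fset_of_list_elem simp del: forces.simps(7))
    have side: "forces R S V y B" if "i < n" "forces R S V y (Y i)" for i y
    proof -
      have "valid R S V ({|Y i|} \<Rrightarrow> {|B|})" using prems RhdP(2) that(1) by (simp del: valid.simps)
      with that(2) show ?thesis by simp
    qed
    have "forces R S V w (A \<rhd> B)" if \<Gamma>: "\<And>F. F |\<in>| ?\<Gamma> \<Longrightarrow> forces R S V w F" for w
    proof (rule ccontr)
      assume "\<not> forces R S V w (A \<rhd> B)"
      then obtain x where x: "R w x" "forces R S V x A" "forces R S V x (A \<rhd> B)"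
        "\<And>y. S w x y \<Longrightarrow> \<not> forces R S V y B"
        by (rule last_counterexample) blast
      have "forces R S V x F" if "F |\<in>| ?\<Gamma>" for F
      proof -
        from that RhdP(4) obtain C D where "F = C \<rhd> D" by fastforce
        with \<Gamma>[OF that] x(1) show ?thesis using forces_rhd_persistent by blast
      qed
      with main x obtain i where i: "i < n" "forces R S V x (X i)" by blast
      then have "X i \<rhd> Y i |\<in>| ?\<Gamma>" by (auto simp: fset_of_list_elem)
      with \<Gamma> i x(1) obtain y where "S w x y" "forces R S V y (Y i)" by fastforce
      with side i x(4) show False by blast
    qed
    then show ?thesis unfolding RhdP(3) by (auto simp del: forces.simps(7))
  next
    case (Cut \<Gamma> A \<Delta> \<Sigma> \<Pi>)
    then show ?thesis using prems by (simp add: ball_Un bex_Un) blast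
  qed (use prems in \<open>auto\<close>)
qed

lemma proof_sound: "is_proof p \<Longrightarrow> valid R S V (conclusion p)"
proof (induction p)
  case (Node r T ps)
  then show ?case using inference_sound[of r "map conclusion ps" T] by auto
qed

end

lemma provable_imp_valid:
  assumes "persistent_frame R S" "provable T"
  shows "valid R S V T"
  using assms persistent_frame.proof_sound unfolding provable_def proof_of_def by blast

section \<open>Cut-free derivability\<close>

definition cf_provable :: "'v sequent \<Rightarrow> bool" where
  "cf_provable T \<longleftrightarrow> (\<exists>p. proof_of p T \<and> cut_free p)"

lemma cf_inference:
  assumes "inference r Ps T" "r \<noteq> Cut" "\<And>P. P \<in> set Ps \<Longrightarrow> cf_provable P"
  shows "cf_provable T"
proof -
  from assms(3) obtain f where f: "\<And>P. P \<in> set Ps \<Longrightarrow> proof_of (f P) P \<and> cut_free (f P)"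
    unfolding cf_provable_def by metis
  then have "map conclusion (map f Ps) = Ps"
    by (simp add: proof_of_def map_idI)
  then have "proof_of (Node r T (map f Ps)) T \<and> cut_free (Node r T (map f Ps))"
    using assms(1,2) f by (auto simp: proof_of_def)
  then show ?thesis unfolding cf_provable_def by blast
qed

lemma cf_weaken_left: "cf_provable (\<Gamma> \<Rrightarrow> \<Delta>) \<Longrightarrow> cf_provable (\<Gamma>' |\<union>| \<Gamma> \<Rrightarrow> \<Delta>)"
  by (induction \<Gamma>') (auto intro: cf_inference[OF inference.WL])

lemma cf_weaken_right: "cf_provable (\<Gamma> \<Rrightarrow> \<Delta>) \<Longrightarrow> cf_provable (\<Gamma> \<Rrightarrow> \<Delta>' |\<union>| \<Delta>)"
  by (induction \<Delta>') (auto intro: cf_inference[OF inference.WR])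

lemma cf_weaken:
  assumes "cf_provable (\<Gamma> \<Rrightarrow> \<Delta>)" "\<Gamma> |\<subseteq>| \<Gamma>'" "\<Delta> |\<subseteq>| \<Delta>'"
  shows "cf_provable (\<Gamma>' \<Rrightarrow> \<Delta>')"
  using cf_weaken_right[OF cf_weaken_left[OF assms(1), of \<Gamma>'], of \<Delta>'] assms(2,3)
  by (simp add: sup_absorb1)

definition rhds :: "'v form fset \<Rightarrow> 'v form fset" where
  "rhds \<Gamma> = ffilter (\<lambda>F. \<exists>C D. F = C \<rhd> D) \<Gamma>"

lemma rhd_in_rhds [simp]: "C \<rhd> D |\<in>| rhds \<Gamma> \<longleftrightarrow> C \<rhd> D |\<in>| \<Gamma>"
  by (auto simp: rhds_def)

lemma rhds_subset: "rhds \<Gamma> |\<subseteq>| \<Gamma>"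
  by (auto simp: rhds_def)

text \<open>The modal rule without indices.  Since \<open>\<Omega>\<close> may overlap the principal formulas, all
  \<open>\<rhd>\<close>-formulas of the antecedent can serve as \<open>\<Omega>\<close>, and any set of them can be principal.\<close>

lemma cf_rhd:
  assumes principal: "\<And>X Y. (X, Y) |\<in>| P \<Longrightarrow> X \<rhd> Y |\<in>| \<Gamma>"
    and main: "cf_provable (finsert A (finsert (A \<rhd> B) (rhds \<Gamma>)) \<Rrightarrow> fst |`| P)"
    and side: "\<And>X Y. (X, Y) |\<in>| P \<Longrightarrow> cf_provable ({|Y|} \<Rrightarrow> {|B|})"
  shows "cf_provable (\<Gamma> \<Rrightarrow> {|A \<rhd> B|})"
proof -
  obtain ps where P: "P = fset_of_list ps" by (metis exists_fset_of_list)
  let ?I = "fset_of_list [0..<length ps]"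
  let ?X = "\<lambda>i. fst (ps ! i)" and ?Y = "\<lambda>i. snd (ps ! i)"
  have nth: "(?X i, ?Y i) |\<in>| P" if "i < length ps" for i
    using that by (simp add: P fset_of_list_elem)
  have "map ?X [0..<length ps] = map fst ps"
    by (intro nth_equalityI) simp_all
  then have X: "?X |`| ?I = fst |`| P"
    unfolding P by (metis fset_of_list_map)
  have \<Omega>: "rhds \<Gamma> |\<union>| (\<lambda>i. ?X i \<rhd> ?Y i) |`| ?I = rhds \<Gamma>"
    using nth principal by (auto simp: fset_of_list_elem)
  have "inference RhdP
      ((finsert A (finsert (A \<rhd> B) (rhds \<Gamma>)) \<Rrightarrow> fst |`| P)
        # map (\<lambda>i. {|?Y i|} \<Rrightarrow> {|B|}) [0..<length ps]) (rhds \<Gamma> \<Rrightarrow> {|A \<rhd> B|})"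
    using inference.RhdP[of "rhds \<Gamma>" A B ?X ?Y "length ps"] unfolding X \<Omega>
    by (simp add: rhds_def)
  then have "cf_provable (rhds \<Gamma> \<Rrightarrow> {|A \<rhd> B|})"
    by (rule cf_inference) (use main side[OF nth] in auto)
  then show ?thesis by (rule cf_weaken) (simp_all add: rhds_subset)
qed

section \<open>Saturated sequents\<close>

primrec subformulas :: "'v form \<Rightarrow> 'v form fset" where
  "subformulas (Var p) = {|Var p|}"
| "subformulas Bot = {|Bot|}"
| "subformulas (Neg A) = finsert (Neg A) (subformulas A)"
| "subformulas (And A B) = finsert (And A B) (subformulas A |\<union>| subformulas B)"
| "subformulas (Or A B) = finsert (Or A B) (subformulas A |\<union>| subformulas B)"
| "subformulas (Imp A B) = finsert (Imp A B) (subformulas A |\<union>| subformulas B)"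
| "subformulas (A \<rhd> B) = finsert (A \<rhd> B) (subformulas A |\<union>| subformulas B)"

lemma subformulas_refl [simp]: "A |\<in>| subformulas A"
  by (cases A) auto

lemma subformulas_trans: "B |\<in>| subformulas A \<Longrightarrow> subformulas B |\<subseteq>| subformulas A"
  by (induction A) auto

definition subformula_closed :: "'v form fset \<Rightarrow> bool" where
  "subformula_closed \<Phi> \<longleftrightarrow> (\<forall>A. A |\<in>| \<Phi> \<longrightarrow> subformulas A |\<subseteq>| \<Phi>)"

lemma subformula_closedD:
  assumes "subformula_closed \<Phi>"
  shows "Neg A |\<in>| \<Phi> \<Longrightarrow> A |\<in>| \<Phi>"
    and "And A B |\<in>| \<Phi> \<Longrightarrow> A |\<in>| \<Phi> \<and> B |\<in>| \<Phi>"
    and "Or A B |\<in>| \<Phi> \<Longrightarrow> A |\<in>| \<Phi> \<and> B |\<in>| \<Phi>"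
    and "Imp A B |\<in>| \<Phi> \<Longrightarrow> A |\<in>| \<Phi> \<and> B |\<in>| \<Phi>"
    and "A \<rhd> B |\<in>| \<Phi> \<Longrightarrow> A |\<in>| \<Phi> \<and> B |\<in>| \<Phi>"
  using assms unfolding subformula_closed_def by fastforce+

lemma subformula_closed_ffUnion: "subformula_closed (ffUnion (subformulas |`| \<Gamma>))"
  unfolding subformula_closed_def
proof (induction \<Gamma>)
  case (insert A \<Gamma>)
  then show ?case using subformulas_trans[of _ A] by (simp; blast)
qed simp

lemma subset_ffUnion_subformulas: "\<Gamma> |\<subseteq>| ffUnion (subformulas |`| \<Gamma>)"
  by (induction \<Gamma>) auto

text \<open>Maximality among the sequents over \<open>\<Phi>\<close> without a cut-free proof, stated one formula at a
  time because that is how the premises of the rules extend their conclusions.\<close>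

definition saturated :: "'v form fset \<Rightarrow> 'v form fset \<Rightarrow> 'v form fset \<Rightarrow> bool" where
  "saturated \<Phi> \<Gamma> \<Delta> \<longleftrightarrow> \<Gamma> |\<subseteq>| \<Phi> \<and> \<Delta> |\<subseteq>| \<Phi> \<and> \<not> cf_provable (\<Gamma> \<Rrightarrow> \<Delta>) \<and>
    (\<forall>A. A |\<in>| \<Phi> \<longrightarrow> A |\<in>| \<Gamma> \<or> cf_provable (finsert A \<Gamma> \<Rrightarrow> \<Delta>)) \<and>
    (\<forall>A. A |\<in>| \<Phi> \<longrightarrow> A |\<in>| \<Delta> \<or> cf_provable (\<Gamma> \<Rrightarrow> finsert A \<Delta>))"

lemma saturated_extension:
  assumes "\<not> cf_provable (\<Gamma> \<Rrightarrow> \<Delta>)" "\<Gamma> |\<subseteq>| \<Phi>" "\<Delta> |\<subseteq>| \<Phi>"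
  obtains \<Gamma>' \<Delta>' where "\<Gamma> |\<subseteq>| \<Gamma>'" "\<Delta> |\<subseteq>| \<Delta>'" "saturated \<Phi> \<Gamma>' \<Delta>'"
proof -
  define Q where "Q = (\<lambda>(G, D). \<Gamma> |\<subseteq>| G \<and> G |\<subseteq>| \<Phi> \<and> \<Delta> |\<subseteq>| D \<and> D |\<subseteq>| \<Phi> \<and>
    \<not> cf_provable (G \<Rrightarrow> D))"
  let ?m = "\<lambda>(G, D). fcard G + fcard D"
  have "Q (\<Gamma>, \<Delta>)" using assms by (simp add: Q_def)
  moreover have "\<forall>T. Q T \<longrightarrow> ?m T < Suc (fcard \<Phi> + fcard \<Phi>)"
    by (auto simp: Q_def less_Suc_eq_le intro!: add_mono fcard_mono)
  ultimately have "\<exists>T. Q T \<and> (\<forall>U. Q U \<longrightarrow> ?m U \<le> ?m T)"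
    by (rule ex_has_greatest_nat)
  then obtain T where T: "Q T" and largest: "\<And>U. Q U \<Longrightarrow> ?m U \<le> ?m T"
    by blast
  obtain G D where [simp]: "T = (G, D)" by (cases T)
  have insert: "\<Gamma> |\<subseteq>| finsert A G \<and> \<Delta> |\<subseteq>| finsert A D" for A
    using T by (auto simp: Q_def)
  have "A |\<in>| G \<or> cf_provable (finsert A G \<Rrightarrow> D)" if "A |\<in>| \<Phi>" for A
    using T largest[of "(finsert A G, D)"] that insert[of A]
    by (auto simp: Q_def fcard_finsert_if split: if_splits)
  moreover have "A |\<in>| D \<or> cf_provable (G \<Rrightarrow> finsert A D)" if "A |\<in>| \<Phi>" for A
    using T largest[of "(G, finsert A D)"] that insert[of A]
    by (auto simp: Q_def fcard_finsert_if split: if_splits)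
  ultimately have "saturated \<Phi> G D" using T by (simp add: Q_def saturated_def)
  with T show thesis by (intro that) (auto simp: Q_def)
qed

lemma saturated_disjoint:
  assumes "saturated \<Phi> \<Gamma> \<Delta>" "A |\<in>| \<Gamma>"
  shows "A |\<notin>| \<Delta>"
proof
  assume "A |\<in>| \<Delta>"
  with assms have "cf_provable (\<Gamma> \<Rrightarrow> \<Delta>)"
    by (intro cf_weaken[OF cf_inference[OF inference.Init[of A]]]) auto
  with assms show False by (simp add: saturated_def)
qed

lemma saturated_Bot: "saturated \<Phi> \<Gamma> \<Delta> \<Longrightarrow> Bot |\<notin>| \<Gamma>"
  using cf_weaken[OF cf_inference[OF inference.BotL], of \<Gamma> \<Delta>] by (auto simp: saturated_def)

text \<open>If one of these closure conditions failed, maximality would make the premises of the rule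
  for the compound formula derivable, and hence the sequent itself, in which that formula
  already occurs.\<close>

lemma saturated_left:
  assumes "subformula_closed \<Phi>" "saturated \<Phi> \<Gamma> \<Delta>"
  shows "Neg A |\<in>| \<Gamma> \<Longrightarrow> A |\<in>| \<Delta>"
    and "And A B |\<in>| \<Gamma> \<Longrightarrow> A |\<in>| \<Gamma> \<and> B |\<in>| \<Gamma>"
    and "Or A B |\<in>| \<Gamma> \<Longrightarrow> A |\<in>| \<Gamma> \<or> B |\<in>| \<Gamma>"
    and "Imp A B |\<in>| \<Gamma> \<Longrightarrow> A |\<in>| \<Delta> \<or> B |\<in>| \<Gamma>"
proof -
  note closed = subformula_closedD[OF assms(1)]
  have unprovable: "\<not> cf_provable (\<Gamma> \<Rrightarrow> \<Delta>)" and "\<Gamma> |\<subseteq>| \<Phi>"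
    and left: "\<And>C. C |\<in>| \<Phi> \<Longrightarrow> C |\<notin>| \<Gamma> \<Longrightarrow> cf_provable (finsert C \<Gamma> \<Rrightarrow> \<Delta>)"
    and right: "\<And>C. C |\<in>| \<Phi> \<Longrightarrow> C |\<notin>| \<Delta> \<Longrightarrow> cf_provable (\<Gamma> \<Rrightarrow> finsert C \<Delta>)"
    using assms(2) unfolding saturated_def by blast+
  then have \<Phi>: "\<And>C. C |\<in>| \<Gamma> \<Longrightarrow> C |\<in>| \<Phi>" by blast
  show "A |\<in>| \<Delta>" if "Neg A |\<in>| \<Gamma>"
    using cf_inference[OF inference.NegL[of \<Gamma> A \<Delta>]] unprovable right closed(1)[OF \<Phi>[OF that]] that
    by (auto simp: finsert_absorb)
  show "A |\<in>| \<Gamma> \<and> B |\<in>| \<Gamma>" if "And A B |\<in>| \<Gamma>"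
    using cf_inference[OF inference.AndL1[of A \<Gamma> \<Delta> B]] cf_inference[OF inference.AndL2[of B \<Gamma> \<Delta> A]]
      unprovable left closed(2)[OF \<Phi>[OF that]] that
    by (auto simp: finsert_absorb)
  show "A |\<in>| \<Gamma> \<or> B |\<in>| \<Gamma>" if "Or A B |\<in>| \<Gamma>"
    using cf_inference[OF inference.OrL[of A \<Gamma> \<Delta> B]] unprovable left closed(3)[OF \<Phi>[OF that]] that
    by (auto simp: finsert_absorb)
  show "A |\<in>| \<Delta> \<or> B |\<in>| \<Gamma>" if "Imp A B |\<in>| \<Gamma>"
    using cf_inference[OF inference.ImpL[of \<Gamma> A \<Delta> B]] unprovable left right closed(4)[OF \<Phi>[OF that]] that
    by (auto simp: finsert_absorb)
qed

lemma saturated_right: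
  assumes "subformula_closed \<Phi>" "saturated \<Phi> \<Gamma> \<Delta>"
  shows "Neg A |\<in>| \<Delta> \<Longrightarrow> A |\<in>| \<Gamma>"
    and "And A B |\<in>| \<Delta> \<Longrightarrow> A |\<in>| \<Delta> \<or> B |\<in>| \<Delta>"
    and "Or A B |\<in>| \<Delta> \<Longrightarrow> A |\<in>| \<Delta> \<and> B |\<in>| \<Delta>"
    and "Imp A B |\<in>| \<Delta> \<Longrightarrow> A |\<in>| \<Gamma> \<and> B |\<in>| \<Delta>"
proof -
  note closed = subformula_closedD[OF assms(1)]
  have unprovable: "\<not> cf_provable (\<Gamma> \<Rrightarrow> \<Delta>)" and "\<Delta> |\<subseteq>| \<Phi>"
    and left: "\<And>C. C |\<in>| \<Phi> \<Longrightarrow> C |\<notin>| \<Gamma> \<Longrightarrow> cf_provable (finsert C \<Gamma> \<Rrightarrow> \<Delta>)"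
    and right: "\<And>C. C |\<in>| \<Phi> \<Longrightarrow> C |\<notin>| \<Delta> \<Longrightarrow> cf_provable (\<Gamma> \<Rrightarrow> finsert C \<Delta>)"
    using assms(2) unfolding saturated_def by blast+
  then have \<Phi>: "\<And>C. C |\<in>| \<Delta> \<Longrightarrow> C |\<in>| \<Phi>" by blast
  show "A |\<in>| \<Gamma>" if "Neg A |\<in>| \<Delta>"
    using cf_inference[OF inference.NegR[of A \<Gamma> \<Delta>]] unprovable left closed(1)[OF \<Phi>[OF that]] that
    by (auto simp: finsert_absorb)
  show "A |\<in>| \<Delta> \<or> B |\<in>| \<Delta>" if "And A B |\<in>| \<Delta>"
    using cf_inference[OF inference.AndR[of \<Gamma> A \<Delta> B]] unprovable right closed(2)[OF \<Phi>[OF that]] that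
    by (auto simp: finsert_absorb)
  show "A |\<in>| \<Delta> \<and> B |\<in>| \<Delta>" if "Or A B |\<in>| \<Delta>"
    using cf_inference[OF inference.OrR1[of \<Gamma> A \<Delta> B]] cf_inference[OF inference.OrR2[of \<Gamma> B \<Delta> A]]
      unprovable right closed(3)[OF \<Phi>[OF that]] that
    by (auto simp: finsert_absorb)
  show "A |\<in>| \<Gamma> \<and> B |\<in>| \<Delta>" if imp: "Imp A B |\<in>| \<Delta>"
  proof (rule ccontr)
    assume "\<not> (A |\<in>| \<Gamma> \<and> B |\<in>| \<Delta>)"
    then have "cf_provable (finsert A \<Gamma> \<Rrightarrow> \<Delta>) \<or> cf_provable (\<Gamma> \<Rrightarrow> finsert B \<Delta>)"
      using left right closed(4)[OF \<Phi>[OF imp]] by blast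
    then have "cf_provable (finsert A \<Gamma> \<Rrightarrow> finsert B \<Delta>)"
      by (auto elim: cf_weaken)
    then show False
      using cf_inference[OF inference.ImpR[of A \<Gamma> B \<Delta>]] unprovable imp
      by (auto simp: finsert_absorb)
  qed
qed

section \<open>The canonical model\<close>

datatype 'v world = World (ant: "'v form fset") (suc: "'v form fset") (tag: "'v form")

text \<open>The last clause of \<open>canR\<close> is what makes \<open>X \<rhd> Y\<close> true at \<open>w\<close>: either \<open>X\<close> is refuted at \<open>x\<close>,
  or some saturated sequent has \<open>Y\<close> on the left and the tag of \<open>x\<close> on the right, and is
  therefore \<open>canS\<close>-related to \<open>x\<close>.  The inclusion of \<open>\<rhd>\<close>-formulas gives transitivity, and
  its strictness gives converse well-foundedness, \<open>\<Phi>\<close> being finite.  Giving every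
  base world \<open>w\<close> the same relation makes the persistence condition on \<open>canS\<close> immediate.\<close>

definition canR :: "'v form fset \<Rightarrow> 'v world \<Rightarrow> 'v world \<Rightarrow> bool" where
  "canR \<Phi> w x \<longleftrightarrow> saturated \<Phi> (ant x) (suc x) \<and> tag x |\<in>| \<Phi> \<and> rhds (ant w) |\<subset>| rhds (ant x) \<and>
    (\<forall>X Y. X \<rhd> Y |\<in>| ant w \<longrightarrow> X |\<in>| suc x \<or> \<not> cf_provable ({|Y|} \<Rrightarrow> {|tag x|}))"

definition canS :: "'v form fset \<Rightarrow> 'v world \<Rightarrow> 'v world \<Rightarrow> 'v world \<Rightarrow> bool" where
  "canS \<Phi> w x y \<longleftrightarrow> saturated \<Phi> (ant y) (suc y) \<and> tag x |\<in>| suc y"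

definition canV :: "'v world \<Rightarrow> 'v \<Rightarrow> bool" where
  "canV w p \<longleftrightarrow> Var p |\<in>| ant w"

lemma canonical_frame: "persistent_frame (canR \<Phi>) (canS \<Phi>)"
proof
  show "canR \<Phi> w y" if "canR \<Phi> w x" "canR \<Phi> x y" for w x y
  proof -
    have "X \<rhd> Y |\<in>| ant x" if "X \<rhd> Y |\<in>| ant w" for X Y
      using \<open>canR \<Phi> w x\<close> that rhd_in_rhds unfolding canR_def by blast
    with that show ?thesis unfolding canR_def by (meson order.strict_trans)
  qed
  have "{(x, w). canR \<Phi> w x} \<subseteq> measure (\<lambda>w. fcard (\<Phi> |-| rhds (ant w)))"
  proof clarify
    fix x w assume R: "canR \<Phi> w x"
    then have "rhds (ant x) |\<subseteq>| \<Phi>" "rhds (ant w) |\<subset>| rhds (ant x)"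
      using rhds_subset unfolding canR_def saturated_def by blast+
    then have "\<Phi> |-| rhds (ant x) |\<subset>| \<Phi> |-| rhds (ant w)" by blast
    then show "(x, w) \<in> measure (\<lambda>w. fcard (\<Phi> |-| rhds (ant w)))"
      by (simp add: pfsubset_fcard_mono)
  qed
  then show "wf {(x, w). canR \<Phi> w x}" using wf_subset wf_measure by blast
qed (simp add: canS_def)

text \<open>The countermodel reading of the modal rule.  Take as principal formulas all \<open>X \<rhd> Y\<close> on the
  left with \<open>Y \<Rrightarrow> B\<close> derivable; then the side premises hold, so the main premise is underivable
  and extends to a world.  It is a proper successor, as \<open>A \<rhd> B\<close> is on its left, but not on the left
  of the given sequent, which has it on the right.\<close>

lemma canonical_counterexample:
  assumes closed: "subformula_closed \<Phi>" and sat: "saturated \<Phi> (ant w) (suc w)"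
    and AB: "A \<rhd> B |\<in>| suc w"
  obtains x where "canR \<Phi> w x" "A |\<in>| ant x" "tag x = B"
proof -
  have sub: "ant w |\<subseteq>| \<Phi>" "suc w |\<subseteq>| \<Phi>" and unprovable: "\<not> cf_provable (ant w \<Rrightarrow> suc w)"
    using sat by (simp_all add: saturated_def)
  let ?P = "{(X, Y). X \<rhd> Y |\<in>| ant w \<and> cf_provable ({|Y|} \<Rrightarrow> {|B|})}"
  have P_\<Phi>: "?P \<subseteq> fset \<Phi> \<times> fset \<Phi>" using sub(1) subformula_closedD(5)[OF closed] by blast
  then have "finite ?P" by (rule finite_subset) simp
  then obtain P where P_eq: "fset P = ?P"
    using that[of "Abs_fset ?P"] by (simp add: Abs_fset_inverse)
  then have P: "(X, Y) |\<in>| P \<longleftrightarrow> X \<rhd> Y |\<in>| ant w \<and> cf_provable ({|Y|} \<Rrightarrow> {|B|})" for X Y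
    by simp
  have "\<not> cf_provable (ant w \<Rrightarrow> {|A \<rhd> B|})"
    using unprovable AB cf_weaken by blast
  then have "\<not> cf_provable (finsert A (finsert (A \<rhd> B) (rhds (ant w))) \<Rrightarrow> fst |`| P)"
    using cf_rhd[of P "ant w" A B] P by blast
  moreover have AB_\<Phi>: "A |\<in>| \<Phi>" "B |\<in>| \<Phi>" "A \<rhd> B |\<in>| \<Phi>"
    using AB sub(2) subformula_closedD(5)[OF closed, of A B] by blast+
  then have "finsert A (finsert (A \<rhd> B) (rhds (ant w))) |\<subseteq>| \<Phi>"
    using sub(1) rhds_subset by blast
  moreover have "fst |`| P |\<subseteq>| \<Phi>" using P_\<Phi> P_eq by fastforce
  ultimately obtain \<Gamma> \<Delta> where
    ext: "finsert A (finsert (A \<rhd> B) (rhds (ant w))) |\<subseteq>| \<Gamma>" "fst |`| P |\<subseteq>| \<Delta>" "saturated \<Phi> \<Gamma> \<Delta>"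
    by (rule saturated_extension)
  have "rhds (ant w) |\<subseteq>| rhds \<Gamma>" using ext(1) by (auto simp: rhds_def)
  moreover have "A \<rhd> B |\<in>| rhds \<Gamma>" using ext(1) by simp
  moreover have "A \<rhd> B |\<notin>| rhds (ant w)" using saturated_disjoint[OF sat] AB by auto
  ultimately have "rhds (ant w) |\<subset>| rhds \<Gamma>" by blast
  moreover have "X |\<in>| \<Delta> \<or> \<not> cf_provable ({|Y|} \<Rrightarrow> {|B|})" if "X \<rhd> Y |\<in>| ant w" for X Y
    using P[of X Y] that ext(2) by force
  ultimately have "canR \<Phi> w (World \<Gamma> \<Delta> B)" using ext(3) AB_\<Phi> by (simp add: canR_def)
  then show thesis using that ext(1) by simp
qed

lemma truth_lemma:
  assumes closed: "subformula_closed \<Phi>" and "saturated \<Phi> (ant w) (suc w)"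
  shows "(F |\<in>| ant w \<longrightarrow> forces (canR \<Phi>) (canS \<Phi>) canV w F) \<and>
    (F |\<in>| suc w \<longrightarrow> \<not> forces (canR \<Phi>) (canS \<Phi>) canV w F)"
  using assms(2)
proof (induction F arbitrary: w)
  case (Var p)
  then show ?case using saturated_disjoint by (fastforce simp: canV_def)
next
  case Bot
  then show ?case using saturated_Bot by auto
next
  case (Neg A)
  then show ?case
    using saturated_left(1)[OF closed Neg.prems, of A] saturated_right(1)[OF closed Neg.prems, of A]
    by auto
next
  case (And A B)
  then show ?case
    using saturated_left(2)[OF closed And.prems, of A B] saturated_right(2)[OF closed And.prems, of A B]
    by auto
next
  case (Or A B)
  then show ?case
    using saturated_left(3)[OF closed Or.prems, of A B] saturated_right(3)[OF closed Or.prems, of A B]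
    by auto
next
  case (Imp A B)
  then show ?case
    using saturated_left(4)[OF closed Imp.prems, of A B] saturated_right(4)[OF closed Imp.prems, of A B]
    by auto
next
  case (Rhd A B)
  have "forces (canR \<Phi>) (canS \<Phi>) canV w (A \<rhd> B)" if "A \<rhd> B |\<in>| ant w"
  proof -
    have "\<exists>y. canS \<Phi> w x y \<and> forces (canR \<Phi>) (canS \<Phi>) canV y B"
      if x: "canR \<Phi> w x" "forces (canR \<Phi>) (canS \<Phi>) canV x A" for x
    proof -
      have "saturated \<Phi> (ant x) (suc x)" using x(1) by (simp add: canR_def)
      then have "A |\<notin>| suc x" using Rhd.IH(1) x(2) by blast
      then have "\<not> cf_provable ({|B|} \<Rrightarrow> {|tag x|})" "tag x |\<in>| \<Phi>"
        using x(1) \<open>A \<rhd> B |\<in>| ant w\<close> unfolding canR_def by blast+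
      moreover have "B |\<in>| \<Phi>"
        using Rhd.prems that \<open>A \<rhd> B |\<in>| ant w\<close> subformula_closedD(5)[OF closed, of A B]
        unfolding saturated_def by blast
      ultimately obtain \<Gamma> \<Delta> where "{|B|} |\<subseteq>| \<Gamma>" "{|tag x|} |\<subseteq>| \<Delta>" "saturated \<Phi> \<Gamma> \<Delta>"
        using saturated_extension[of "{|B|}" "{|tag x|}" \<Phi>] by auto
      \<comment> \<open>Only the two sides of the new world matter; its tag is arbitrary.\<close>
      then have "canS \<Phi> w x (World \<Gamma> \<Delta> Bot) \<and>
          forces (canR \<Phi>) (canS \<Phi>) canV (World \<Gamma> \<Delta> Bot) B"
        using Rhd.IH(2)[of "World \<Gamma> \<Delta> Bot"] by (simp add: canS_def[of _ w x])
      then show ?thesis by blast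
    qed
    then show ?thesis by simp
  qed
  moreover have "\<not> forces (canR \<Phi>) (canS \<Phi>) canV w (A \<rhd> B)" if AB: "A \<rhd> B |\<in>| suc w"
  proof -
    obtain x where x: "canR \<Phi> w x" "A |\<in>| ant x" "tag x = B"
      using canonical_counterexample[OF closed Rhd.prems AB] .
    then have "forces (canR \<Phi>) (canS \<Phi>) canV x A"
      using Rhd.IH(1)[of x] unfolding canR_def by blast
    moreover have "\<not> forces (canR \<Phi>) (canS \<Phi>) canV y B" if "canS \<Phi> w x y" for y
      using Rhd.IH(2)[of y] that x(3) unfolding canS_def by blast
    ultimately show ?thesis using x(1) by auto
  qed
  ultimately show ?case by blast
qed
section \<open>Cut elimination\<close>

theorem theorem3p7:
  fixes S :: "'v sequent"
  assumes "provable S"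
  shows "\<exists>p. proof_of p S \<and> cut_free p"
proof (rule ccontr)
  assume no_proof: "\<not> ?thesis"
  obtain \<Gamma> \<Delta> where S: "S = \<Gamma> \<Rrightarrow> \<Delta>" by (cases S)
  let ?\<Phi> = "ffUnion (subformulas |`| (\<Gamma> |\<union>| \<Delta>))"
  have closed: "subformula_closed ?\<Phi>" by (rule subformula_closed_ffUnion)
  have "\<Gamma> |\<union>| \<Delta> |\<subseteq>| ?\<Phi>" by (rule subset_ffUnion_subformulas)
  then have "\<Gamma> |\<subseteq>| ?\<Phi>" "\<Delta> |\<subseteq>| ?\<Phi>" by blast+
  moreover have "\<not> cf_provable (\<Gamma> \<Rrightarrow> \<Delta>)" using no_proof by (simp add: S cf_provable_def)
  ultimately obtain \<Gamma>' \<Delta>' where ext: "\<Gamma> |\<subseteq>| \<Gamma>'" "\<Delta> |\<subseteq>| \<Delta>'" "saturated ?\<Phi> \<Gamma>' \<Delta>'"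
    using saturated_extension[of \<Gamma> \<Delta> ?\<Phi>] by blast
  let ?w = "World \<Gamma>' \<Delta>' Bot"
  have "valid (canR ?\<Phi>) (canS ?\<Phi>) canV (\<Gamma> \<Rrightarrow> \<Delta>)"
    using provable_imp_valid[OF canonical_frame] assms S by blast
  moreover have "forces (canR ?\<Phi>) (canS ?\<Phi>) canV ?w F" if "F |\<in>| \<Gamma>" for F
    using truth_lemma[OF closed, of ?w F] ext that by auto
  moreover have "\<not> forces (canR ?\<Phi>) (canS ?\<Phi>) canV ?w F" if "F |\<in>| \<Delta>" for F
    using truth_lemma[OF closed, of ?w F] ext that by auto
  ultimately show False by auto
qed

end
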